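(* Let $G=\mathrm{SN}(n,\mathcal{A})$ be a SetNim game, let $\mathcal{P}$ be its set of $\mathcal{P}$-positions, and let $\{\boldsymbol{z}_i\}_{i\in I}$ be the set of zero-one vectors that are invariant for $\mathcal{P}$. Suppose that for every position $\boldsymbol{p}$ of $G$ there exist non-negative integers $c_i$ ($i\in I$) such that $\tilde{\boldsymbol{p}}=\boldsymbol{p}-\sum_{i\in I}c_i\boldsymbol{z}_i$ is a position of $G$ (i.e. $\tilde{\boldsymbol{p}}\ge\boldsymbol{0}$) whose non-zero stacks are all contained in some set $A\in\mathcal{A}$. Then $\mathcal{P}$ equals the set of all linear combinations $\sum_{i\in I}c_i\boldsymbol{z}_i$ of the invariant vectors with non-negative integer coefficients $c_i$.
   Context: The game SetNim $\mathrm{SN}(n,\mathcal{A})$ is played on $n$ stacks of tokens placed on a vertex set $V$ with $|V|=n$, where $\mathcal{A}=\{A_1,\ldots,A_\ell\}$ is a collection of subsets of $V$ with $\bigcup_i A_i=V$. A position is a vector of $n$ non-negative integers (the stack heights). In each move a player selects a set $A_i\in\mathcal{A}$ and removes at least one token in total from the stacks in $A_i$ (any number of tokens may be removed from each stack of $A_i$, including none, as long as at least one token is removed overall). Two players alternate, and the last player to move wins. An $\mathcal{N}$-position is one from which the player about to move can win with optimal play; a $\mathcal{P}$-position is one from which the player about to move loses against optimal play. A zero-one vector is a vector all of whose entries are $0$ or $1$. A zero-one vector $\boldsymbol{z}$ of length $n$ is called invariant for a set $S$ of positions if for every position $\boldsymbol{p}$ and every integer $c$ with $\boldsymbol{p}+c\boldsymbol{z}\ge\boldsymbol{0}$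 (entrywise), $\boldsymbol{p}\in S$ if and only if $\boldsymbol{p}+c\boldsymbol{z}\in S$. *)

theory Defs imports Main begin

text \<open>
  A vector indexed by \<open>V\<close> is a function \<open>'v \<Rightarrow> int\<close> that is 0 outside \<open>V\<close>, so that equality of
  vectors is equality of functions. Integer entries let \<open>p + c z\<close> and \<open>p - \<Sum>\<^sub>i c\<^sub>i z\<^sub>i\<close> be formed
  without truncation.
\<close>

definition set_nim :: "nat \<Rightarrow> 'v set \<Rightarrow> 'v set set \<Rightarrow> bool" where
  "set_nim n V \<A> \<longleftrightarrow> finite V \<and> card V = n \<and> \<Union>\<A> = V"

definition vector_on :: "'v set \<Rightarrow> ('v \<Rightarrow> int) \<Rightarrow> bool" where
  "vector_on V x \<longleftrightarrow> (\<forall>v. v \<notin> V \<longrightarrow> x v = 0)"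

definition position :: "'v set \<Rightarrow> ('v \<Rightarrow> int) \<Rightarrow> bool" where
  "position V p \<longleftrightarrow> vector_on V p \<and> (\<forall>v\<in>V. 0 \<le> p v)"

definition move :: "'v set \<Rightarrow> 'v set set \<Rightarrow> ('v \<Rightarrow> int) \<Rightarrow> ('v \<Rightarrow> int) \<Rightarrow> bool" where
  "move V \<A> p q \<longleftrightarrow> position V p \<and> position V q \<and>
     (\<exists>A\<in>\<A>. (\<forall>v\<in>A. q v \<le> p v) \<and> (\<forall>v\<in>V - A. q v = p v) \<and> (\<exists>v\<in>A. q v < p v))"

text \<open>
  Normal play: a player who cannot move has lost. Being defined inductively, \<open>N_position\<close> says that
  the player about to move can force a win in finitely many moves, and \<open>P_position\<close> that the
  opponent can.
\<close>

inductive N_position :: "'v set \<Rightarrow> 'v set set \<Rightarrow> ('v \<Rightarrow> int) \<Rightarrow> bool"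
  and P_position :: "'v set \<Rightarrow> 'v set set \<Rightarrow> ('v \<Rightarrow> int) \<Rightarrow> bool"
  for V :: "'v set" and \<A> :: "'v set set"
where
  N_positionI: "move V \<A> p q \<Longrightarrow> P_position V \<A> q \<Longrightarrow> N_position V \<A> p"
| P_positionI: "position V p \<Longrightarrow> (\<forall>q. move V \<A> p q \<longrightarrow> N_position V \<A> q) \<Longrightarrow> P_position V \<A> p"

definition P_positions :: "'v set \<Rightarrow> 'v set set \<Rightarrow> ('v \<Rightarrow> int) set" where
  "P_positions V \<A> = {p. P_position V \<A> p}"

definition zero_one_vector :: "'v set \<Rightarrow> ('v \<Rightarrow> int) \<Rightarrow> bool" where
  "zero_one_vector V z \<longleftrightarrow> vector_on V z \<and> (\<forall>v\<in>V. z v = 0 \<or> z v = 1)"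

definition invariant_for :: "'v set \<Rightarrow> ('v \<Rightarrow> int) set \<Rightarrow> ('v \<Rightarrow> int) \<Rightarrow> bool" where
  "invariant_for V S z \<longleftrightarrow>
     (\<forall>p c. position V p \<longrightarrow> (\<forall>v\<in>V. 0 \<le> p v + c * z v) \<longrightarrow>
        (p \<in> S \<longleftrightarrow> (\<lambda>v. p v + c * z v) \<in> S))"

definition invariant_vectors :: "'v set \<Rightarrow> 'v set set \<Rightarrow> ('v \<Rightarrow> int) set" where
  "invariant_vectors V \<A> = {z. zero_one_vector V z \<and> invariant_for V (P_positions V \<A>) z}"

text \<open>The family \<open>z\<^sub>i\<close> is indexed by its own elements: \<open>c z\<close> is the coefficient of \<open>z\<close>.\<close>

definition lin_comb :: "('v \<Rightarrow> int) set \<Rightarrow> (('v \<Rightarrow> int) \<Rightarrow> nat) \<Rightarrow> 'v \<Rightarrow> int" where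
  "lin_comb Z c = (\<lambda>v. \<Sum>z\<in>Z. int (c z) * z v)"

text \<open>The sum in \<open>lin_comb\<close> over the invariant vectors is a genuine finite sum:\<close>

lemma finite_invariant_vectors:
  assumes "finite V"
  shows "finite (invariant_vectors V \<A>)"
proof (rule finite_subset)
  show "invariant_vectors V \<A> \<subseteq> {z. (\<forall>v. (v \<in> V \<longrightarrow> z v \<in> {0, 1}) \<and> (v \<notin> V \<longrightarrow> z v = 0))}"
    by (auto simp: invariant_vectors_def zero_one_vector_def vector_on_def)
  show "finite {z :: 'a \<Rightarrow> int. (\<forall>v. (v \<in> V \<longrightarrow> z v \<in> {0, 1}) \<and> (v \<notin> V \<longrightarrow> z v = 0))}"
    using assms by (intro finite_set_of_finite_funs) auto
qed

end

theory Submission imports Defs begin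

text \<open>
  Adding a non-negative combination of invariant vectors to a position never changes whether it
  is a \<open>\<P>\<close>-position, since the vectors can be added one at a time and no entry ever becomes negative
  (\<open>add_invariant_combination\<close>). As \<open>0\<close> is a terminal position, it is a \<open>\<P>\<close>-position, and hence so is
  every such combination.

  Conversely, the hypothesis writes a \<open>\<P>\<close>-position as \<open>q\<close> plus a combination, where the support of
  \<open>q\<close> lies in some \<open>A \<in> \<A>\<close>. Then \<open>q\<close> is a \<open>\<P>\<close>-position as well. If \<open>q\<close> were non-zero, the player
  to move could win at once by clearing all stacks of \<open>A\<close>; so \<open>q = 0\<close>
  (\<open>P_position_supported_on_move_set\<close>) and the position is itself a combination.
\<close>

lemma no_move_from_zero:
  assumes "\<Union>\<A> \<subseteq> V"
  shows "\<not> move V \<A> (\<lambda>v. 0) q"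
proof
  assume "move V \<A> (\<lambda>v. 0) q"
  then obtain A v where "A \<in> \<A>" "v \<in> A" "q v < 0" and "position V q"
    by (auto simp: move_def)
  moreover from this have "v \<in> V"
    using assms by auto
  ultimately show False
    by (auto simp: position_def dest: bspec[of _ _ v])
qed

lemma zero_position: "position V (\<lambda>v. 0)"
  by (simp add: position_def vector_on_def)

lemma P_position_zero:
  assumes "\<Union>\<A> \<subseteq> V"
  shows "P_position V \<A> (\<lambda>v. 0)"
  using no_move_from_zero[OF assms] zero_position by (blast intro: P_positionI)

lemma P_position_imp_position: "P_position V \<A> p \<Longrightarrow> position V p"
  by (auto elim: P_position.cases)

text \<open>
  From a non-zero position supported in \<open>A\<close> the move to \<open>0\<close> is legal, so \<open>0\<close> would have to be an
  \<open>\<N>\<close>-position, which is impossible because no move leads out of it.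
\<close>

lemma P_position_supported_on_move_set:
  assumes "\<Union>\<A> \<subseteq> V" and P: "P_position V \<A> q"
    and A: "A \<in> \<A>" "{v \<in> V. q v \<noteq> 0} \<subseteq> A"
  shows "q = (\<lambda>v. 0)"
proof (rule ccontr)
  assume nz: "q \<noteq> (\<lambda>v. 0)"
  have pos: "position V q"
    using P by (rule P_position_imp_position)
  have nonneg: "0 \<le> q v" for v
    using pos by (cases "v \<in> V") (auto simp: position_def vector_on_def)
  obtain v where "q v \<noteq> 0"
    using nz by (auto simp: fun_eq_iff)
  moreover from this have "v \<in> V"
    using pos by (auto simp: position_def vector_on_def)
  ultimately have "v \<in> A" "0 < q v"
    using A(2) nonneg[of v] by auto
  then have "move V \<A> q (\<lambda>v. 0)"
    using pos zero_position A nonneg unfolding move_def by (intro conjI bexI[of _ A]) auto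
  with P have "N_position V \<A> (\<lambda>v. 0)"
    by (auto elim: P_position.cases)
  then obtain q' where "move V \<A> (\<lambda>v. 0) q'"
    by (auto elim: N_position.cases)
  then show False
    using no_move_from_zero[OF assms(1)] by simp
qed

lemma position_add_zero_one:
  assumes "position V p" "zero_one_vector V z"
  shows "position V (\<lambda>v. p v + int k * z v)"
proof -
  have "0 \<le> z v" if "v \<in> V" for v
    using assms(2) that by (auto simp: zero_one_vector_def dest!: bspec[of _ _ v])
  then show ?thesis
    using assms by (simp add: position_def zero_one_vector_def vector_on_def)
qed

text \<open>
  This is stated for every finite set of invariant zero-one vectors so that it can be proved by
  induction on that set. The partial sums have to be known to be positions, because invariance
  only speaks about positions.
\<close>

lemma add_invariant_combination:
  assumes "finite Z" "\<And>z. z \<in> Z \<Longrightarrow> zero_one_vector V z \<and> invariant_for V S z" "position V p"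
  shows "position V (\<lambda>v. p v + lin_comb Z c v) \<and> (p \<in> S \<longleftrightarrow> (\<lambda>v. p v + lin_comb Z c v) \<in> S)"
  using assms
proof (induction Z rule: finite_induct)
  case empty
  then show ?case by (simp add: lin_comb_def)
next
  case (insert z Z)
  define r where "r = (\<lambda>v. p v + lin_comb Z c v)"
  have r: "position V r" "p \<in> S \<longleftrightarrow> r \<in> S"
    using insert.IH insert.prems by (auto simp: r_def)
  have sum_insert: "(\<lambda>v. p v + lin_comb (insert z Z) c v) = (\<lambda>v. r v + int (c z) * z v)"
    using insert.hyps by (simp add: r_def lin_comb_def algebra_simps)
  have z: "zero_one_vector V z" "invariant_for V S z"
    using insert.prems by auto
  have pos: "position V (\<lambda>v. r v + int (c z) * z v)"
    using r(1) z(1) by (rule position_add_zero_one)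
  then have "r \<in> S \<longleftrightarrow> (\<lambda>v. r v + int (c z) * z v) \<in> S"
    using z(2) r(1) unfolding invariant_for_def position_def by blast
  with r(2) pos show ?case
    unfolding sum_insert by simp
qed

theorem proposition3p4:
  fixes n :: nat and V :: "'v set" and \<A> :: "'v set set"
  assumes "set_nim n V \<A>"
    and "\<And>p. position V p \<Longrightarrow>
      \<exists>c q. q = (\<lambda>v. p v - lin_comb (invariant_vectors V \<A>) c v) \<and> position V q \<and>
        (\<exists>A\<in>\<A>. {v \<in> V. q v \<noteq> 0} \<subseteq> A)"
  shows "P_positions V \<A> = {lin_comb (invariant_vectors V \<A>) c |c. True}"
proof -
  let ?L = "lin_comb (invariant_vectors V \<A>)"
  have sub: "\<Union>\<A> \<subseteq> V" and fin: "finite (invariant_vectors V \<A>)"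
    using assms(1) finite_invariant_vectors by (auto simp: set_nim_def)
  have shift: "P_position V \<A> p \<longleftrightarrow> P_position V \<A> (\<lambda>v. p v + ?L c v)" if "position V p" for p c
    using add_invariant_combination[OF fin _ that, where S = "P_positions V \<A>" and c = c]
    by (simp add: invariant_vectors_def P_positions_def)
  have "P_position V \<A> (?L c)" for c
    using shift[OF zero_position, of c] P_position_zero[OF sub] by simp
  moreover have "\<exists>c. p = ?L c" if P: "P_position V \<A> p" for p
  proof -
    obtain c q A where q: "q = (\<lambda>v. p v - ?L c v)" "position V q"
      and A: "A \<in> \<A>" "{v \<in> V. q v \<noteq> 0} \<subseteq> A"
      using assms(2)[OF P_position_imp_position[OF P]] by blast
    have p: "p = (\<lambda>v. q v + ?L c v)"
      by (simp add: q(1))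
    with P have "P_position V \<A> q"
      using shift[OF q(2), of c] by simp
    then have "q = (\<lambda>v. 0)"
      using P_position_supported_on_move_set[OF sub] A by blast
    with p show ?thesis
      by auto
  qed
  ultimately show ?thesis
    by (auto simp: P_positions_def)
qed

end
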